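(* Let $g,\sigma,M>0$ and let $[\gamma]\in\mathbb R$ satisfy $0<[\gamma]/\sigma<1$. Then there exists a smooth equilibrium, with $u=0$, constant pressure $P_0$, endpoints $L_0<R_0$ and profile $\zeta_0:[L_0,R_0]\to[0,\infty)$, satisfying $$g\zeta_0-\sigma\,\partial_{z_1}\left(\frac{\partial_{z_1}\zeta_0}{\sqrt{1+|\partial_{z_1}\zeta_0|^2}}\right)=P_0 \quad\text{on }(L_0,R_0),$$ $$|\partial_{z_1}\zeta_0(L_0)|=|\partial_{z_1}\zeta_0(R_0)|=\frac{\sqrt{\sigma^2-[\gamma]^2}}{[\gamma]},\qquad \zeta_0(L_0)=\zeta_0(R_0)=0,$$ $$\int_{L_0}^{R_0}\zeta_0(z_1)\,dz_1=M,\qquad P_0=C_1(M,g,\sigma,[\gamma]),\qquad R_0-L_0=C_2(M,g,\sigma,[\gamma]),$$ where $C_1(M,g,\sigma,[\gamma])$ and $C_2(M,g,\sigma,[\gamma])$ are positive constants depending on $M,g,\sigma,[\gamma]$. Moreover, the equilibrium is unique up to a common shift of $L_0$ and $R_0$ and a corresponding translation of $\zeta_0$.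
   Context: This concerns steady states of a 2D viscous droplet on a flat line under gravity $g$ and surface tension $\sigma$, occupying $\{L_0<z_1<R_0,\ 0<z_2<\zeta_0(z_1)\}$; $M$ is the droplet area. The profile of a droplet is a function that is positive in the open interval $(L_0,R_0)$ and vanishes at the endpoints. $[\gamma]$ is the difference of the solid-vapor and solid-fluid free energy coefficients. *)

theory Defs
  imports "HOL-Analysis.Analysis"
begin

text \<open>Smoothness up to the boundary on a compact interval: \<open>D n\<close> is the \<open>n\<close>-th derivative,
  one-sided at the two endpoints. Values of \<open>f\<close> outside the interval are irrelevant.\<close>

definition smooth_on_Icc :: "(real \<Rightarrow> real) \<Rightarrow> real \<Rightarrow> real \<Rightarrow> bool" where
  "smooth_on_Icc f a b \<longleftrightarrow>
     (\<exists>D :: nat \<Rightarrow> real \<Rightarrow> real.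
        (\<forall>x\<in>{a..b}. D 0 x = f x) \<and>
        (\<forall>n. \<forall>x\<in>{a..b}. (D n has_real_derivative D (Suc n) x) (at x within {a..b})))"

definition droplet :: "real \<Rightarrow> real \<Rightarrow> (real \<Rightarrow> real) \<Rightarrow> (real \<times> real) set" where
  "droplet L R \<zeta> = {(z1, z2). L < z1 \<and> z1 < R \<and> 0 < z2 \<and> z2 < \<zeta> z1}"

text \<open>The profile is a function on \<open>[L, R]\<close>, and the velocity \<open>u\<close> and the pressure \<open>p\<close> are fields
  on the droplet; all three are represented by total functions that are constrained only there.
  Smoothness of \<open>\<zeta>\<close> makes every derivative below a genuine one; at the endpoints it is the
  one-sided derivative relative to \<open>[L, R]\<close>.\<close>

definition equilibrium ::
  "real \<Rightarrow> real \<Rightarrow> real \<Rightarrow> real \<Rightarrow> (real \<times> real \<Rightarrow> real \<times> real) \<Rightarrow> (real \<times> real \<Rightarrow> real) \<Rightarrow>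
   real \<Rightarrow> real \<Rightarrow> real \<Rightarrow> (real \<Rightarrow> real) \<Rightarrow> bool" where
  "equilibrium M g \<sigma> \<gamma> u p P0 L R \<zeta> \<longleftrightarrow>
     L < R \<and>
     smooth_on_Icc \<zeta> L R \<and>
     (\<forall>z\<in>{L<..<R}. 0 < \<zeta> z) \<and> \<zeta> L = 0 \<and> \<zeta> R = 0 \<and>
     (\<forall>z\<in>droplet L R \<zeta>. u z = 0) \<and>
     (\<forall>z\<in>droplet L R \<zeta>. p z = P0) \<and>
     (\<forall>z\<in>{L<..<R}.
        g * \<zeta> z - \<sigma> * deriv (\<lambda>y. deriv \<zeta> y / sqrt (1 + \<bar>deriv \<zeta> y\<bar>\<^sup>2)) z = P0) \<and>
     \<bar>vector_derivative \<zeta> (at L within {L..R})\<bar> = sqrt (\<sigma>\<^sup>2 - \<gamma>\<^sup>2) / \<gamma> \<and>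
     \<bar>vector_derivative \<zeta> (at R within {L..R})\<bar> = sqrt (\<sigma>\<^sup>2 - \<gamma>\<^sup>2) / \<gamma> \<and>
     (\<zeta> has_integral M) {L..R}"

end

theory Submission
  imports Defs
begin

text \<open>
  The equilibrium equation is the capillary equation of a two-dimensional sessile drop, and it is
  solved by using the inclination angle \<open>\<theta>\<close> as the independent variable. Put \<open>k = g / \<sigma>\<close>,
  \<open>p = P\<^sub>0 / \<sigma>\<close> and \<open>w = sin \<theta> = \<zeta>' / sqrt (1 + \<zeta>'\<^sup>2)\<close>. The equation says \<open>w' = - q\<close> for the
  curvature \<open>q = p - k \<zeta>\<close>. Since \<open>q' = - k tan \<theta>\<close>, the energy \<open>q\<^sup>2 + 2 k cos \<theta>\<close> is constant,
  that is, \<open>q\<^sup>2 = A + 2 k (1 - cos \<theta>)\<close> with \<open>A\<close> the squared curvature at a horizontal point of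
  the profile. The contact condition says that \<open>w\<close> runs from \<open>w0 = sqrt (1 - (\<gamma> / \<sigma>)\<^sup>2)\<close> to
  \<open>- w0\<close>.

  For an arbitrary equilibrium \<open>q\<close> stays positive (\<open>equilibrium_characterization\<close>). So \<open>q\<close> is the
  function \<open>curvature k A w\<close> of \<open>w\<close>, and the equation \<open>w' = - curvature k A w\<close> separates: with
  \<open>T' = - 1 / curvature k A\<close> the difference \<open>T (w z) - z\<close> is constant. The number \<open>A\<close> therefore
  determines the width \<open>R - L\<close>, the pressure (the height is 0 where \<open>w = w0\<close>, so
  \<open>p = curvature k A w0\<close>) and, up to a translation, the profile. Conversely, the inverse of \<open>T\<close>
  yields an equilibrium for each \<open>A > 0\<close> (\<open>equilibrium_exists\<close>).

  It remains to match \<open>A\<close> with the area. Integration of \<open>w' = k \<zeta> - p\<close> over the drop gives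
  \<open>p (R - L) = k M + 2 w0\<close>, whose left side as a function of \<open>A\<close> is \<open>pressure_width k w0\<close>.
  This function is continuous and strictly decreasing (\<open>pressure_width_strict_antimono\<close>). It is
  unbounded as \<open>A\<close> tends to 0, since \<open>1 / curvature k 0 s\<close> is of order \<open>1 / \<bar>s\<bar>\<close> near 0 and not
  integrable, and it tends to \<open>2 w0\<close> as \<open>A\<close> tends to infinity. So each area \<open>M > 0\<close> belongs to
  exactly one \<open>A\<close> (\<open>pressure_width_inj\<close>, \<open>pressure_width_surj\<close>).
\<close>

section \<open>Width of a drop as a function of its apex curvature\<close>

text \<open>Curvature of the profile at a point of inclination \<open>\<theta>\<close>, in terms of \<open>s = sin \<theta>\<close>: the energy
  identity gives the square of the curvature as \<open>A + 2 k (1 - cos \<theta>)\<close>, where \<open>A\<close> is its value at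
  the apex. For \<open>\<bar>s\<bar> > 1\<close> the formula stays continuous and positive, because \<open>sqrt\<close> is extended
  as an odd function; so the primitive of \<open>1 / curvature k A\<close> can be taken on the whole line.\<close>

definition curvature :: "real \<Rightarrow> real \<Rightarrow> real \<Rightarrow> real" where
  "curvature k A s = sqrt (A + 2 * k * (1 - sqrt (1 - s\<^sup>2)))"

text \<open>Along the profile the sine of the inclination decreases at the rate \<open>curvature k A\<close>, from \<open>w\<close> at
  the left contact point to \<open>-w\<close> at the right one.\<close>

definition width :: "real \<Rightarrow> real \<Rightarrow> real \<Rightarrow> real" where
  "width k w A = integral {-w..w} (\<lambda>s. 1 / curvature k A s)"

lemma curvature_pos:
  assumes "0 < k" "0 < A"
  shows "0 < curvature k A s"
  unfolding curvature_def real_sqrt_gt_0_iff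
  using assms by (intro add_pos_nonneg) auto

lemma curvature_uminus [simp]: "curvature k A (- s) = curvature k A s"
  by (simp add: curvature_def)

lemma continuous_on_curvature [continuous_intros]:
  assumes "continuous_on S f" "continuous_on S g"
  shows "continuous_on S (\<lambda>x. curvature k (f x) (g x))"
  unfolding curvature_def by (intro continuous_intros assms)

lemma continuous_on_inverse_curvature:
  assumes "0 < k" "0 < A"
  shows "continuous_on S (\<lambda>s. 1 / curvature k A s)"
  using curvature_pos[OF assms] by (intro continuous_intros) (auto simp: less_imp_neq[THEN not_sym])

lemma curvature_strict_mono:
  assumes "0 < k" "\<bar>s\<bar> < w" "w \<le> 1"
  shows "curvature k A s < curvature k A w"
proof -
  have "s\<^sup>2 < w\<^sup>2"
    using assms by (simp add: power2_strict_mono)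
  then have "sqrt (1 - w\<^sup>2) < sqrt (1 - s\<^sup>2)"
    by simp
  with assms show ?thesis
    unfolding curvature_def by simp
qed

text \<open>The height vanishes at a contact point, so the curvature there is the pressure divided by the
  surface tension. The product with the width is what integration of the equilibrium equation
  over the drop determines from the area.\<close>

definition pressure_width :: "real \<Rightarrow> real \<Rightarrow> real \<Rightarrow> real" where
  "pressure_width k w A = curvature k A w * width k w A"

lemma pressure_width_eq_integral:
  "pressure_width k w A = integral {-w..w} (\<lambda>s. curvature k A w / curvature k A s)"
  unfolding pressure_width_def width_def by (simp flip: integral_mult_right)

text \<open>With \<open>h x = 2 k (1 - sqrt (1 - x\<^sup>2))\<close> the squared ratio is \<open>(A + h w) / (A + h s)\<close>, which falls
  strictly to 1 as \<open>A\<close> grows, because \<open>h s < h w\<close>.\<close>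

lemma curvature_ratio_strict_antimono:
  assumes k: "0 < k" and A: "0 < A" "A < B" and s: "\<bar>s\<bar> < w" and w: "w \<le> 1"
  shows "curvature k B w / curvature k B s < curvature k A w / curvature k A s"
proof -
  define h where "h x = 2 * k * (1 - sqrt (1 - x\<^sup>2))" for x
  have h0: "0 \<le> h s"
    using k by (simp add: h_def)
  have "s\<^sup>2 < w\<^sup>2"
    using s by (simp add: power2_strict_mono)
  then have hw: "h s < h w"
    using k by (simp add: h_def)
  have "(B - A) * h s < (B - A) * h w"
    using hw A by simp
  then have "(B + h w) * (A + h s) < (A + h w) * (B + h s)"
    by (simp add: algebra_simps)
  then have "(B + h w) / (B + h s) < (A + h w) / (A + h s)"
    using A h0 by (simp add: field_simps)
  then have "sqrt ((B + h w) / (B + h s)) < sqrt ((A + h w) / (A + h s))"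
    by simp
  then show ?thesis
    by (simp add: curvature_def h_def real_sqrt_divide)
qed

lemma pressure_width_strict_antimono:
  assumes k: "0 < k" and A: "0 < A" "A < B" and w: "0 < w" "w \<le> 1"
  shows "pressure_width k w B < pressure_width k w A"
proof -
  have cont: "continuous_on {-w..w} (\<lambda>s. curvature k C w / curvature k C s)" if "0 < C" for C
    using curvature_pos[OF k that]
    by (intro continuous_intros) (auto simp: less_imp_neq[THEN not_sym])
  show ?thesis
    unfolding pressure_width_eq_integral
  proof (rule integral_less_real)
    fix s assume "s \<in> {-w<..<w}"
    then show "curvature k B w / curvature k B s < curvature k A w / curvature k A s"
      using curvature_ratio_strict_antimono[OF k A _ w(2)] by auto
  qed (use cont A w in auto)
qed

lemma pressure_width_inj:
  assumes "0 < k" "0 < w" "w \<le> 1" "0 < A" "0 < B"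
    and "pressure_width k w A = pressure_width k w B"
  shows "A = B"
  using pressure_width_strict_antimono[of k A B w] pressure_width_strict_antimono[of k B A w] assms
  by (cases A B rule: linorder_cases) auto

lemma continuous_on_pressure_width:
  assumes k: "0 < k" and S: "S \<subseteq> {0<..}"
  shows "continuous_on S (pressure_width k w)"
proof -
  have "continuous_on (S \<times> cbox (-w) w) (\<lambda>(A, s). 1 / curvature k A s)"
    unfolding case_prod_beta
    using curvature_pos[OF k] S
    by (intro continuous_intros) (auto simp: less_imp_neq[THEN not_sym])
  then have "continuous_on S (\<lambda>A. integral (cbox (-w) w) (\<lambda>s. 1 / curvature k A s))"
    by (rule integral_continuous_on_param)
  then have "continuous_on S (width k w)"
    by (simp add: width_def)
  then show ?thesis
    unfolding pressure_width_def by (intro continuous_intros)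
qed

lemma curvature_le_linear:
  assumes k: "0 < k" and s: "0 \<le> s" "s \<le> 1" and a: "0 \<le> a"
  shows "curvature k (a\<^sup>2) s \<le> a + sqrt (2 * k) * s"
proof -
  have "1 - s\<^sup>2 \<le> sqrt (1 - s\<^sup>2)"
  proof (rule real_le_rsqrt)
    have "0 \<le> s\<^sup>2" "s\<^sup>2 \<le> 1"
      using s by (auto simp: power_le_one)
    then show "(1 - s\<^sup>2)\<^sup>2 \<le> 1 - s\<^sup>2"
      using power_decreasing[of 1 2 "1 - s\<^sup>2"] by simp
  qed
  then have "2 * k * (1 - sqrt (1 - s\<^sup>2)) \<le> 2 * k * s\<^sup>2"
    using k by (intro mult_left_mono) auto
  also have "\<dots> = (sqrt (2 * k) * s)\<^sup>2"
    using k by (simp add: power_mult_distrib)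
  finally have "a\<^sup>2 + 2 * k * (1 - sqrt (1 - s\<^sup>2)) \<le> a\<^sup>2 + (sqrt (2 * k) * s)\<^sup>2"
    by simp
  also have "\<dots> \<le> (a + sqrt (2 * k) * s)\<^sup>2"
    using k s a by (simp add: power2_sum)
  finally show ?thesis
    unfolding curvature_def using k s a by (intro real_le_lsqrt) auto
qed

text \<open>A drop of small apex curvature is wide: the integrand of the width is at least
  \<open>1 / (a + b s)\<close> on \<open>[0, w]\<close>, and the integral of this diverges logarithmically as \<open>a\<close> tends to 0.\<close>

lemma width_ge_log:
  assumes k: "0 < k" and w: "0 < w" "w \<le> 1" and a: "0 < a"
  defines "b \<equiv> sqrt (2 * k)"
  shows "(ln (b * w) - ln a) / b \<le> width k w (a\<^sup>2)"
proof -
  have b: "0 < b"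
    using k by (simp add: b_def)
  have "((\<lambda>s. 1 / (a + b * s)) has_integral ln (a + b * w) / b - ln (a + b * 0) / b) {0..w}"
  proof (rule fundamental_theorem_of_calculus)
    fix s assume s: "s \<in> {0..w}"
    then have "0 < a + b * s"
      using a b by (simp add: add_pos_nonneg)
    then have "((\<lambda>s. ln (a + b * s) / b) has_real_derivative b / (a + b * s) / b) (at s within {0..w})"
      using b by (auto intro!: derivative_eq_intros)
    then show "((\<lambda>s. ln (a + b * s) / b) has_vector_derivative 1 / (a + b * s)) (at s within {0..w})"
      using b by (simp add: has_real_derivative_iff_has_vector_derivative)
  qed (use w in simp)
  then have int: "((\<lambda>s. 1 / (a + b * s)) has_integral (ln (a + b * w) - ln a) / b) {0..w}"
    by (simp add: diff_divide_distrib)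
  have cont: "continuous_on S (\<lambda>s. 1 / curvature k (a\<^sup>2) s)" for S
    using k a by (intro continuous_on_inverse_curvature) auto
  have pos: "0 < curvature k (a\<^sup>2) s" for s
    using k a by (intro curvature_pos) auto
  have "(ln (b * w) - ln a) / b \<le> (ln (a + b * w) - ln a) / b"
    using a b w by (intro divide_right_mono diff_right_mono ln_mono) auto
  also have "\<dots> = integral {0..w} (\<lambda>s. 1 / (a + b * s))"
    using int by (simp add: integral_unique)
  also have "\<dots> \<le> integral {0..w} (\<lambda>s. 1 / curvature k (a\<^sup>2) s)"
  proof (rule integral_le)
    show "(\<lambda>s. 1 / (a + b * s)) integrable_on {0..w}"
      using int by blast
    show "(\<lambda>s. 1 / curvature k (a\<^sup>2) s) integrable_on {0..w}"
      by (intro integrable_continuous_interval cont)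
    fix s assume "s \<in> {0..w}"
    then show "1 / (a + b * s) \<le> 1 / curvature k (a\<^sup>2) s"
      using curvature_le_linear[OF k, of s a] a w pos[of s]
      by (intro divide_left_mono) (auto simp: b_def intro!: mult_pos_pos add_pos_nonneg k)
  qed
  also have "\<dots> \<le> width k w (a\<^sup>2)"
    unfolding width_def
  proof (rule integral_subset_le)
    show "(\<lambda>s. 1 / curvature k (a\<^sup>2) s) integrable_on {0..w}"
      "(\<lambda>s. 1 / curvature k (a\<^sup>2) s) integrable_on {-w..w}"
      by (intro integrable_continuous_interval cont)+
  qed (use w pos in \<open>auto simp: less_imp_le\<close>)
  finally show ?thesis .
qed

text \<open>For large \<open>A\<close> gravity is negligible, the curvature is nearly constant, and the bound tends to
  the value \<open>2 w\<close> that a circular arc has.\<close>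

lemma pressure_width_le:
  assumes k: "0 < k" and w: "0 < w" "w \<le> 1" and A: "0 < A"
  shows "pressure_width k w A \<le> 2 * w * (1 + 2 * k / A)"
proof -
  have "curvature k A w / curvature k A s \<le> 1 + 2 * k / A" for s
  proof -
    have "sqrt A \<le> curvature k A s"
      using k by (simp add: curvature_def)
    moreover have "curvature k A w \<le> sqrt (A + 2 * k)"
      using k w by (simp add: curvature_def power_le_one)
    ultimately have "curvature k A w / curvature k A s \<le> sqrt (A + 2 * k) / sqrt A"
      using k A by (intro frac_le) auto
    also have "\<dots> = sqrt (1 + 2 * k / A)"
      using A by (simp add: add_divide_distrib flip: real_sqrt_divide)
    also have "\<dots> \<le> 1 + 2 * k / A"
      using k A by (intro real_le_lsqrt self_le_power) auto
    finally show ?thesis .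
  qed
  then have "pressure_width k w A \<le> integral {-w..w} (\<lambda>s. 1 + 2 * k / A)"
    unfolding pressure_width_eq_integral
    using curvature_pos[OF k A]
    by (intro integral_le integrable_continuous_interval continuous_intros)
       (auto simp: less_imp_neq[THEN not_sym])
  then show ?thesis
    using w by (simp add: algebra_simps)
qed

text \<open>Every value above that of the circular arc is attained, by the intermediate value theorem
  between the logarithmic lower bound and the upper bound for large \<open>A\<close>.\<close>

lemma pressure_width_surj:
  assumes k: "0 < k" and w: "0 < w" "w \<le> 1" and N: "2 * w < N"
  obtains A where "0 < A" "pressure_width k w A = N"
proof -
  define h where "h = 2 * k * (1 - sqrt (1 - w\<^sup>2))"
  define b where "b = sqrt (2 * k)"
  have h: "0 < h"
    using k w by (simp add: h_def)
  have b: "0 < b"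
    using k by (simp add: b_def)
  \<comment> \<open>At this apex curvature the logarithmic lower bound on the width equals \<open>N / sqrt h\<close>,
     while the pressure is at least \<open>sqrt h\<close>.\<close>
  define a where "a = b * w * exp (- (N * b / sqrt h))"
  define B where "B = max (a\<^sup>2) (4 * k * w / (N - 2 * w))"
  have a: "0 < a"
    using b w by (simp add: a_def)
  have B: "0 < B"
    using a by (simp add: B_def less_max_iff_disj)
  have "ln a = ln (b * w) - N * b / sqrt h"
    using b w by (simp add: a_def ln_mult)
  then have "(ln (b * w) - ln a) / b = N / sqrt h"
    using b by simp
  then have "N / sqrt h \<le> width k w (a\<^sup>2)"
    using width_ge_log[OF k w a] by (simp add: b_def)
  moreover have "sqrt h \<le> curvature k (a\<^sup>2) w"
    by (simp add: curvature_def h_def)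
  ultimately have "sqrt h * (N / sqrt h) \<le> pressure_width k w (a\<^sup>2)"
    unfolding pressure_width_def using h w N curvature_pos[OF k, of "a\<^sup>2" w] a
    by (intro mult_mono) auto
  then have lower: "N \<le> pressure_width k w (a\<^sup>2)"
    using h by simp
  have "4 * k * w / (N - 2 * w) \<le> B"
    by (simp add: B_def)
  then have "4 * k * w \<le> B * (N - 2 * w)"
    using N by (simp add: pos_divide_le_eq)
  then have "2 * w * (1 + 2 * k / B) \<le> N"
    using B by (simp add: field_simps)
  then have upper: "pressure_width k w B \<le> N"
    using pressure_width_le[OF k w B] by linarith
  have "continuous_on {a\<^sup>2..B} (pressure_width k w)"
    using k a by (intro continuous_on_pressure_width) (auto intro: less_le_trans[of 0 "a\<^sup>2"])
  then obtain A where "a\<^sup>2 \<le> A" "pressure_width k w A = N"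
    using IVT2'[of "pressure_width k w" B N "a\<^sup>2"] upper lower by (auto simp: B_def)
  moreover from a have "0 < a\<^sup>2"
    by simp
  ultimately show thesis
    using that[of A] by (metis less_le_trans)
qed

section \<open>The position of a point of prescribed inclination\<close>

text \<open>As \<open>dw/dz = - curvature k A w\<close> along the profile, a primitive of \<open>- 1 / curvature k A\<close> recovers,
  up to a shift, the position \<open>z\<close> from the sine \<open>w\<close> of the inclination. It is the separation of
  variables that makes both the uniqueness and the construction of the profile explicit.\<close>

lemma inclination_position_exists:
  assumes k: "0 < k" and A: "0 < A"
  obtains T where "\<And>s. (T has_real_derivative - 1 / curvature k A s) (at s)"
proof -
  have "continuous_on UNIV (\<lambda>s. - (1 / curvature k A s))"
    by (intro continuous_intros continuous_on_inverse_curvature k A)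
  then have "isCont (\<lambda>s. - (1 / curvature k A s)) s" for s
    by (simp add: continuous_on_eq_continuous_at)
  then have "\<exists>T. \<forall>s. -\<infinity> < ereal s \<longrightarrow> ereal s < \<infinity> \<longrightarrow>
      (T has_vector_derivative - (1 / curvature k A s)) (at s)"
    by (intro einterval_antiderivative) auto
  then show thesis
    using that by (auto simp: has_real_derivative_iff_has_vector_derivative)
qed

lemma inclination_position_strict_antimono:
  assumes k: "0 < k" and A: "0 < A"
    and T: "\<And>s. (T has_real_derivative - 1 / curvature k A s) (at s)"
    and "s < t"
  shows "T t < T s"
proof (rule DERIV_neg_imp_decreasing[of s t T])
  fix x
  show "\<exists>y. (T has_real_derivative y) (at x) \<and> y < 0"
    using T[of x] curvature_pos[OF k A, of x] by (intro exI[of _ "- 1 / curvature k A x"]) simp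
qed fact

lemma inclination_position_inj:
  assumes "0 < k" "0 < A"
    and "\<And>s. (T has_real_derivative - 1 / curvature k A s) (at s)"
  shows "inj T"
  using inclination_position_strict_antimono[OF assms]
  by (intro injI) (metis less_irrefl linorder_neqE)

lemma width_eq_inclination_position_diff:
  assumes T: "\<And>s. (T has_real_derivative - 1 / curvature k A s) (at s)" and w: "0 \<le> w"
  shows "width k w A = T (- w) - T w"
proof -
  have "((\<lambda>s. - 1 / curvature k A s) has_integral T w - T (- w)) {-w..w}"
    using T w
    by (intro fundamental_theorem_of_calculus)
       (auto simp flip: has_real_derivative_iff_has_vector_derivative intro: DERIV_subset)
  from has_integral_neg[OF this] show ?thesis
    by (simp add: width_def integral_unique)
qed

section \<open>Sine and cosine of the inclination\<close>

lemma sine_of_slope_deriv: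
  "((\<lambda>y. y / sqrt (1 + y\<^sup>2)) has_real_derivative 1 / sqrt (1 + y\<^sup>2) ^ 3) (at y)"
proof -
  have pos: "0 < 1 + y\<^sup>2"
    by (simp add: add_pos_nonneg)
  define r where "r = sqrt (1 + y\<^sup>2)"
  have r: "0 < r" "r\<^sup>2 = 1 + y\<^sup>2"
    using pos by (simp_all add: r_def)
  have "((\<lambda>y. y / sqrt (1 + y\<^sup>2)) has_real_derivative (r - y * (y / r)) / (r * r)) (at y)"
    using pos by (auto intro!: derivative_eq_intros simp: r_def divide_simps)
  also have "(r - y * (y / r)) / (r * r) = (r\<^sup>2 - y\<^sup>2) / r ^ 3"
    using r(1) by (simp add: field_simps power2_eq_square power3_eq_cube)
  finally show ?thesis
    using r by (simp add: r_def)
qed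

lemma cosine_of_slope_deriv:
  "((\<lambda>y. 1 / sqrt (1 + y\<^sup>2)) has_real_derivative - y * (1 / sqrt (1 + y\<^sup>2) ^ 3)) (at y)"
proof -
  have pos: "0 < 1 + y\<^sup>2"
    by (simp add: add_pos_nonneg)
  define r where "r = sqrt (1 + y\<^sup>2)"
  have r: "0 < r"
    using pos by (simp add: r_def)
  have "((\<lambda>y. 1 / sqrt (1 + y\<^sup>2)) has_real_derivative - (y / r) / (r * r)) (at y)"
    using pos by (auto intro!: derivative_eq_intros simp: r_def divide_simps)
  also have "- (y / r) / (r * r) = - y * (1 / r ^ 3)"
    by (simp add: power3_eq_cube)
  finally show ?thesis
    by (simp add: r_def)
qed

lemma cosine_of_slope_eq: "sqrt (1 - (y / sqrt (1 + y\<^sup>2))\<^sup>2) = 1 / sqrt (1 + y\<^sup>2)" for y :: real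
proof -
  have "0 < 1 + y\<^sup>2"
    by (simp add: add_pos_nonneg)
  then have "1 - (y / sqrt (1 + y\<^sup>2))\<^sup>2 = 1 / (1 + y\<^sup>2)"
    by (simp add: power_divide field_simps)
  then show ?thesis
    by (simp add: real_sqrt_divide)
qed

text \<open>For the tangent \<open>y\<close> and the cosine \<open>c\<close> of an inclination,
  \<open>y\<^sup>2 / (1 + y\<^sup>2) = 1 - c\<^sup>2 \<le> 2 (1 - c)\<close>. On a smooth profile the slope is bounded, so
  the energy bounds the square of the slope by that of the curvature.\<close>

lemma slope_square_le:
  fixes y :: real
  assumes "\<bar>y\<bar> \<le> B"
  shows "y\<^sup>2 / (1 + B\<^sup>2) \<le> 2 * (1 - 1 / sqrt (1 + y\<^sup>2))"
proof -
  define c where "c = 1 / sqrt (1 + y\<^sup>2)"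
  have pos: "0 < 1 + y\<^sup>2"
    by (simp add: add_pos_nonneg)
  have "y\<^sup>2 \<le> B\<^sup>2"
    using assms abs_le_square_iff[of y B] by simp
  then have "y\<^sup>2 / (1 + B\<^sup>2) \<le> y\<^sup>2 / (1 + y\<^sup>2)"
    using pos by (intro divide_left_mono) (auto simp: add_pos_nonneg)
  also have "\<dots> = 1 - c\<^sup>2"
    using pos by (simp add: c_def power_divide field_simps)
  also have "\<dots> \<le> 2 * (1 - c)"
    using zero_le_power2[of "c - 1"] by (simp add: power2_diff)
  finally show ?thesis
    by (simp add: c_def)
qed

text \<open>The prescribed contact slope \<open>\<tau>\<close> is the tangent of the contact angle with cosine \<open>\<gamma> / \<sigma>\<close>.\<close>

lemma contact_slope:
  fixes \<sigma> \<gamma> :: real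
  assumes \<sigma>: "0 < \<sigma>" and \<gamma>: "0 < \<gamma>"
    and lt: "\<gamma> < \<sigma>"
  defines "\<tau> \<equiv> sqrt (\<sigma>\<^sup>2 - \<gamma>\<^sup>2) / \<gamma>"
  shows "0 < \<tau>" "sqrt (1 + \<tau>\<^sup>2) = \<sigma> / \<gamma>" "\<tau> / sqrt (1 + \<tau>\<^sup>2) = sqrt (1 - (\<gamma> / \<sigma>)\<^sup>2)"
proof -
  have sq: "\<gamma>\<^sup>2 < \<sigma>\<^sup>2"
    using lt \<gamma> by (intro power_strict_mono) auto
  then show "0 < \<tau>"
    using \<gamma> by (simp add: \<tau>_def)
  have "1 + \<tau>\<^sup>2 = (\<sigma> / \<gamma>)\<^sup>2"
    using sq \<gamma> by (simp add: \<tau>_def power_divide field_simps)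
  then show *: "sqrt (1 + \<tau>\<^sup>2) = \<sigma> / \<gamma>"
    using \<sigma> \<gamma> by simp
  have "1 - (\<gamma> / \<sigma>)\<^sup>2 = (\<sigma>\<^sup>2 - \<gamma>\<^sup>2) / \<sigma>\<^sup>2"
    using \<sigma> by (simp add: power_divide field_simps)
  then show "\<tau> / sqrt (1 + \<tau>\<^sup>2) = sqrt (1 - (\<gamma> / \<sigma>)\<^sup>2)"
    unfolding * using \<sigma> \<gamma> by (simp add: \<tau>_def real_sqrt_divide)
qed

section \<open>Every equilibrium is a translate of the explicit one\<close>

text \<open>The differential inequality makes \<open>exp (K x) f x\<close> nondecreasing.\<close>

lemma gronwall_pos:
  fixes f f' :: "real \<Rightarrow> real"
  assumes cont: "continuous_on {a..b} f"
    and f': "\<And>x. a < x \<Longrightarrow> x < b \<Longrightarrow> (f has_real_derivative f' x) (at x)"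
    and ineq: "\<And>x. a < x \<Longrightarrow> x < b \<Longrightarrow> - K * f x \<le> f' x"
    and "0 < f a" and x: "a \<le> x" "x \<le> b"
  shows "0 < f x"
proof -
  have "exp (K * a) * f a \<le> exp (K * x) * f x"
  proof (rule DERIV_nonneg_imp_increasing_open[of a x "\<lambda>t. exp (K * t) * f t"])
    fix t assume t: "a < t" "t < x"
    then have "((\<lambda>t. exp (K * t) * f t) has_real_derivative exp (K * t) * (K * f t + f' t)) (at t)"
      using x f'[of t] by (auto intro!: derivative_eq_intros simp: algebra_simps)
    moreover have "0 \<le> K * f t + f' t"
      using ineq[of t] t x by simp
    ultimately show "\<exists>y. ((\<lambda>t. exp (K * t) * f t) has_real_derivative y) (at t) \<and> 0 \<le> y"
      by (meson exp_ge_zero mult_nonneg_nonneg)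
  next
    show "continuous_on {a..x} (\<lambda>t. exp (K * t) * f t)"
      using x by (intro continuous_intros continuous_on_subset[OF cont]) auto
  qed fact
  moreover have "0 < exp (K * a) * f a"
    using \<open>0 < f a\<close> by simp
  ultimately have "0 < exp (K * x) * f x"
    by linarith
  then show ?thesis
    by (simp add: zero_less_mult_iff)
qed

text \<open>The contact condition prescribes only the absolute value of the slope; positivity of the
  profile in the interior supplies the sign.\<close>

lemma endpoint_slope_sign:
  fixes f :: "real \<Rightarrow> real"
  assumes ab: "a < b" and pos: "\<And>x. x \<in> {a<..<b} \<Longrightarrow> 0 < f x" and 0: "f a = 0" "f b = 0"
    and da: "(f has_real_derivative da) (at a within {a..b})"
    and db: "(f has_real_derivative db) (at b within {a..b})"
  shows "0 \<le> da" "db \<le> 0"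
proof -
  show "0 \<le> da"
  proof (rule ccontr)
    assume "\<not> 0 \<le> da"
    then obtain d where "0 < d" and d: "\<And>h. 0 < h \<Longrightarrow> a + h \<in> {a..b} \<Longrightarrow> h < d \<Longrightarrow> f (a + h) < f a"
      using has_real_derivative_neg_dec_right[OF da] by auto
    obtain h where "0 < h" "h < min d (b - a)"
      using dense[of 0 "min d (b - a)"] ab \<open>0 < d\<close> by auto
    then show False
      using d[of h] pos[of "a + h"] 0 by auto
  qed
  show "db \<le> 0"
  proof (rule ccontr)
    assume "\<not> db \<le> 0"
    then obtain d where "0 < d" and d: "\<And>h. 0 < h \<Longrightarrow> b - h \<in> {a..b} \<Longrightarrow> h < d \<Longrightarrow> f (b - h) < f b"
      using has_real_derivative_pos_inc_left[OF db] by auto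
    obtain h where "0 < h" "h < min d (b - a)"
      using dense[of 0 "min d (b - a)"] ab \<open>0 < d\<close> by auto
    then show False
      using d[of h] pos[of "b - h"] 0 by auto
  qed
qed

text \<open>The conditions rewritten as the first-order system for the sine and cosine of the
  inclination. The derivatives of sine and cosine are claimed only in the interior, where the
  equation holds; continuity up to the contact points suffices for the conservation laws.\<close>

lemma equilibrium_reduced:
  assumes eq: "equilibrium M g \<sigma> \<gamma> u P P0 L R \<zeta>"
    and \<sigma>: "0 < \<sigma>" and \<gamma>: "0 < \<gamma>" "\<gamma> < \<sigma>"
  defines "k \<equiv> g / \<sigma>" and "p \<equiv> P0 / \<sigma>" and "w0 \<equiv> sqrt (1 - (\<gamma> / \<sigma>)\<^sup>2)"
  obtains y where
    "\<And>z. z \<in> {L..R} \<Longrightarrow> (\<zeta> has_real_derivative y z) (at z within {L..R})"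
    "continuous_on {L..R} y"
    "\<And>z. z \<in> {L<..<R} \<Longrightarrow> ((\<lambda>z. y z / sqrt (1 + (y z)\<^sup>2)) has_real_derivative - (p - k * \<zeta> z)) (at z)"
    "\<And>z. z \<in> {L<..<R} \<Longrightarrow> ((\<lambda>z. 1 / sqrt (1 + (y z)\<^sup>2)) has_real_derivative y z * (p - k * \<zeta> z)) (at z)"
    "y L / sqrt (1 + (y L)\<^sup>2) = w0" "y R / sqrt (1 + (y R)\<^sup>2) = - w0"
proof -
  from eq have LR: "L < R" and pos: "\<And>z. z \<in> {L<..<R} \<Longrightarrow> 0 < \<zeta> z" and 0: "\<zeta> L = 0" "\<zeta> R = 0"
    and ode: "\<And>z. z \<in> {L<..<R} \<Longrightarrow>
        g * \<zeta> z - \<sigma> * deriv (\<lambda>y. deriv \<zeta> y / sqrt (1 + (deriv \<zeta> y)\<^sup>2)) z = P0"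
    and contact: "\<bar>vector_derivative \<zeta> (at L within {L..R})\<bar> = sqrt (\<sigma>\<^sup>2 - \<gamma>\<^sup>2) / \<gamma>"
      "\<bar>vector_derivative \<zeta> (at R within {L..R})\<bar> = sqrt (\<sigma>\<^sup>2 - \<gamma>\<^sup>2) / \<gamma>"
    unfolding equilibrium_def by auto
  from eq obtain D where D0: "\<And>x. x \<in> {L..R} \<Longrightarrow> D 0 x = \<zeta> x"
    and D: "\<And>n x. x \<in> {L..R} \<Longrightarrow> (D n has_real_derivative D (Suc n) x) (at x within {L..R})"
    unfolding equilibrium_def smooth_on_Icc_def by metis
  define y where "y = D (Suc 0)"
  have d\<zeta>: "(\<zeta> has_real_derivative y z) (at z within {L..R})" if "z \<in> {L..R}" for z
    unfolding y_def
    by (rule has_field_derivative_transform_within[OF D[OF that], of 1]) (use D0 that in auto)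
  have cont: "continuous_on {L..R} y"
    using D[of _ "Suc 0"] unfolding y_def by (rule DERIV_continuous_on)
  have deriv: "deriv \<zeta> z = y z" if "z \<in> {L<..<R}" for z
    using d\<zeta>[of z] that by (intro DERIV_imp_deriv) (auto simp: at_within_Icc_at)
  have dy: "(y has_real_derivative D 2 z) (at z)" if "z \<in> {L<..<R}" for z
    using D[of z "Suc 0"] that by (auto simp: y_def at_within_Icc_at numeral_2_eq_2)
  have dw: "((\<lambda>z. y z / sqrt (1 + (y z)\<^sup>2)) has_real_derivative 1 / sqrt (1 + (y z)\<^sup>2) ^ 3 * D 2 z) (at z)"
    if "z \<in> {L<..<R}" for z
    using DERIV_chain2[OF sine_of_slope_deriv dy[OF that]] .
  have curv: "1 / sqrt (1 + (y z)\<^sup>2) ^ 3 * D 2 z = - (p - k * \<zeta> z)" if z: "z \<in> {L<..<R}" for z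
  proof -
    have "((\<lambda>z. deriv \<zeta> z / sqrt (1 + (deriv \<zeta> z)\<^sup>2)) has_real_derivative 1 / sqrt (1 + (y z)\<^sup>2) ^ 3 * D 2 z) (at z)"
      by (rule has_field_derivative_transform_within_open[OF dw[OF z], of "{L<..<R}"])
         (use z deriv in auto)
    from DERIV_imp_deriv[OF this]
    have "g * \<zeta> z - \<sigma> * (1 / sqrt (1 + (y z)\<^sup>2) ^ 3 * D 2 z) = P0"
      using ode[OF z] by simp
    then show ?thesis
      using \<sigma> by (simp add: k_def p_def field_simps)
  qed
  have dc: "((\<lambda>z. 1 / sqrt (1 + (y z)\<^sup>2)) has_real_derivative y z * (p - k * \<zeta> z)) (at z)"
    if z: "z \<in> {L<..<R}" for z
  proof -
    have "- y z * (1 / sqrt (1 + (y z)\<^sup>2) ^ 3) * D 2 z = y z * (p - k * \<zeta> z)"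
      using curv[OF z] by (metis minus_mult_commute minus_minus mult.assoc)
    then show ?thesis
      using DERIV_chain2[OF cosine_of_slope_deriv dy[OF z]] by simp
  qed
  have vd: "vector_derivative \<zeta> (at z within {L..R}) = y z" if "z \<in> {L..R}" for z
    using d\<zeta>[OF that] that LR
    by (intro vector_derivative_within_closed_interval)
       (auto simp: has_real_derivative_iff_has_vector_derivative)
  have "0 \<le> y L" "y R \<le> 0"
    using endpoint_slope_sign[OF LR pos 0 d\<zeta> d\<zeta>] LR by auto
  then have "y L = sqrt (\<sigma>\<^sup>2 - \<gamma>\<^sup>2) / \<gamma>" "y R = - (sqrt (\<sigma>\<^sup>2 - \<gamma>\<^sup>2) / \<gamma>)"
    using contact vd[of L] vd[of R] LR by auto
  then have "y L / sqrt (1 + (y L)\<^sup>2) = w0" "y R / sqrt (1 + (y R)\<^sup>2) = - w0"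
    using contact_slope(3)[OF \<sigma> \<gamma>] by (simp_all add: w0_def)
  then show thesis
    using that[of y] d\<zeta> cont dw curv dc by simp
qed

text \<open>Write \<open>w\<close> and \<open>c\<close> for the sine and cosine of the inclination, \<open>y\<close> for its tangent, and
  \<open>q = p - k \<zeta>\<close> for the curvature. The equations \<open>w' = -q\<close>, \<open>c' = y q\<close>, \<open>q' = - k y\<close>
  conserve \<open>q\<^sup>2 + 2 k c\<close>, so that \<open>q\<^sup>2\<close> is the function \<open>A + 2 k (1 - c)\<close> of the inclination. The
  point that needs an argument is that \<open>q\<close> has no zero, for only then is \<open>q\<close> itself determined by
  the inclination, and \<open>A > 0\<close>. It follows from \<open>q > 0\<close> at the left endpoint, where \<open>q\<close> is the
  pressure, and from an exponential lower bound for \<open>q\<^sup>2\<close>; it excludes solutions that level off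
  towards the flat film \<open>\<zeta> = p / k\<close>, or that rise again.\<close>

lemma equilibrium_characterization:
  assumes eq: "equilibrium M g \<sigma> \<gamma> u P P0 L R \<zeta>"
    and M: "0 < M" and g: "0 < g" and \<sigma>: "0 < \<sigma>" and \<gamma>: "0 < \<gamma>" "\<gamma> < \<sigma>"
  defines "k \<equiv> g / \<sigma>" and "w0 \<equiv> sqrt (1 - (\<gamma> / \<sigma>)\<^sup>2)"
  obtains A where "0 < A" "P0 = \<sigma> * curvature k A w0" "R - L = width k w0 A"
    "pressure_width k w0 A = k * M + 2 * w0"
    "\<And>T z. (\<And>s. (T has_real_derivative - 1 / curvature k A s) (at s)) \<Longrightarrow> z \<in> {L..R} \<Longrightarrow>
       \<exists>s. T s = T w0 + (z - L) \<and> \<zeta> z = (curvature k A w0 - curvature k A s) / k"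
proof -
  define p where "p = P0 / \<sigma>"
  obtain y where
    d\<zeta>: "\<And>z. z \<in> {L..R} \<Longrightarrow> (\<zeta> has_real_derivative y z) (at z within {L..R})" and
    cont_y: "continuous_on {L..R} y" and
    dw: "\<And>z. z \<in> {L<..<R} \<Longrightarrow> ((\<lambda>z. y z / sqrt (1 + (y z)\<^sup>2)) has_real_derivative - (p - k * \<zeta> z)) (at z)" and
    dc: "\<And>z. z \<in> {L<..<R} \<Longrightarrow> ((\<lambda>z. 1 / sqrt (1 + (y z)\<^sup>2)) has_real_derivative y z * (p - k * \<zeta> z)) (at z)" and
    ends: "y L / sqrt (1 + (y L)\<^sup>2) = w0" "y R / sqrt (1 + (y R)\<^sup>2) = - w0"
    using equilibrium_reduced[OF eq \<sigma> \<gamma>] unfolding k_def p_def w0_def by blast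
  from eq have LR: "L < R" and 0: "\<zeta> L = 0" "\<zeta> R = 0" and area: "(\<zeta> has_integral M) {L..R}"
    unfolding equilibrium_def by auto
  have k: "0 < k"
    using g \<sigma> by (simp add: k_def)
  have "(\<gamma> / \<sigma>)\<^sup>2 < 1"
    using \<sigma> \<gamma> by (simp add: power_less_one_iff)
  then have w0: "0 < w0"
    by (simp add: w0_def)
  define w where "w = (\<lambda>z. y z / sqrt (1 + (y z)\<^sup>2))"
  define c where "c = (\<lambda>z. 1 / sqrt (1 + (y z)\<^sup>2))"
  define q where "q = (\<lambda>z. p - k * \<zeta> z)"
  have nz: "1 + (y z)\<^sup>2 \<noteq> 0" for z
    by (metis add_pos_nonneg less_irrefl zero_le_power2 zero_less_one)
  have cont_\<zeta>: "continuous_on {L..R} \<zeta>"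
    using d\<zeta> by (rule DERIV_continuous_on)
  have cont_w: "continuous_on {L..R} w" and cont_c: "continuous_on {L..R} c"
    and cont_q: "continuous_on {L..R} q"
    unfolding w_def c_def q_def
    by (auto intro!: continuous_intros cont_y cont_\<zeta> simp: nz)
  have dq: "(q has_real_derivative - k * y z) (at z)" if z: "z \<in> {L<..<R}" for z
  proof -
    have "(\<zeta> has_real_derivative y z) (at z)"
      using d\<zeta>[of z] z by (auto simp: at_within_Icc_at)
    then show ?thesis
      unfolding q_def by (auto intro!: derivative_eq_intros)
  qed

  \<comment> \<open>The slope vanishes somewhere, and there \<open>c = 1\<close>; this fixes the energy.\<close>
  have "\<exists>z. L < z \<and> z < R \<and> (\<lambda>h. h * y z) = (\<lambda>h. 0)"
  proof (rule Rolle_deriv[OF LR _ cont_\<zeta>])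
    fix z assume "L < z" "z < R"
    then show "(\<zeta> has_derivative (\<lambda>h. h * y z)) (at z)"
      using d\<zeta>[of z] by (auto simp: at_within_Icc_at has_field_derivative_def mult.commute[of _ "y z"])
  qed (simp add: 0)
  then obtain m where m: "m \<in> {L<..<R}" "y m = 0"
    by (auto dest: fun_cong[of _ _ 1])
  define A where "A = (q m)\<^sup>2"
  have "(q z)\<^sup>2 + 2 * k * c z = (q L)\<^sup>2 + 2 * k * c L" if "z \<in> {L..R}" for z
  proof (rule DERIV_isconst2[OF LR])
    show "continuous_on {L..R} (\<lambda>z. (q z)\<^sup>2 + 2 * k * c z)"
      by (intro continuous_intros cont_q cont_c)
    fix z assume "L < z" "z < R"
    then have "(q has_real_derivative - k * y z) (at z)" "(c has_real_derivative y z * q z) (at z)"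
      using dq[of z] dc[of z] by (auto simp: c_def q_def)
    then show "((\<lambda>z. (q z)\<^sup>2 + 2 * k * c z) has_real_derivative 0) (at z)"
      by (auto intro!: derivative_eq_intros)
  qed (use that in auto)
  note energy_const = this
  have energy: "(q z)\<^sup>2 = A + 2 * k * (1 - c z)" if "z \<in> {L..R}" for z
    using energy_const[OF that] energy_const[of m] m by (auto simp: A_def c_def algebra_simps)

  \<comment> \<open>Integrating the equilibrium equation over the drop gives the width in terms of the area,
     and shows that the pressure is positive.\<close>
  have "((\<lambda>z. - q z) has_integral w R - w L) {L..R}"
    using LR cont_w dw
    by (intro fundamental_theorem_of_calculus_interior)
       (auto simp: w_def q_def simp flip: has_real_derivative_iff_has_vector_derivative)
  moreover have "((\<lambda>z. - q z) has_integral k * M - p * (R - L)) {L..R}"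
  proof -
    have "((\<lambda>z. k * \<zeta> z - p) has_integral k * M - (R - L) *\<^sub>R p) {L..R}"
      using LR has_integral_const_real[of p L R]
      by (intro has_integral_diff has_integral_mult_right area) auto
    then show ?thesis
      by (simp add: q_def mult.commute)
  qed
  ultimately have mass: "p * (R - L) = k * M + 2 * w0"
    using ends by (auto simp: w_def dest: has_integral_unique)
  have "0 < k * M + 2 * w0"
    using k M w0 by (simp add: add_pos_pos)
  then have p: "0 < p"
    using mass LR by (metis diff_gt_0_iff_gt zero_less_mult_pos2)

  \<comment> \<open>The energy makes \<open>q\<^sup>2\<close> dominate the square of the slope, so \<open>q\<^sup>2\<close> cannot decay to 0.\<close>
  obtain B where B: "\<And>z. z \<in> {L..R} \<Longrightarrow> \<bar>y z\<bar> \<le> B"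
    using compact_continuous_image[OF cont_y compact_Icc, THEN compact_imp_bounded]
    unfolding bounded_iff by (metis imageI real_norm_def)
  \<comment> \<open>Split \<open>2 k q y\<close> as \<open>q\<^sup>2 + k\<^sup>2 y\<^sup>2\<close>; the second square is at most \<open>k (1 + B\<^sup>2) q\<^sup>2\<close>.\<close>
  define K where "K = 1 + k * (1 + B\<^sup>2)"
  have q_sq: "0 < (q z)\<^sup>2" if z: "z \<in> {L..R}" for z
  proof (rule gronwall_pos[where f = "\<lambda>z. (q z)\<^sup>2" and a = L and b = R and K = K
        and f' = "\<lambda>z. 2 * q z * (- k * y z)"])
    show "continuous_on {L..R} (\<lambda>z. (q z)\<^sup>2)"
      by (intro continuous_intros cont_q)
    show "0 < (q L)\<^sup>2"
      using p 0 by (simp add: q_def)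
  next
    fix z assume "L < z" "z < R"
    then show "((\<lambda>z. (q z)\<^sup>2) has_real_derivative 2 * q z * (- k * y z)) (at z)"
      using dq[of z] by (auto intro!: derivative_eq_intros)
  next
    fix z assume "L < z" "z < R"
    then have z: "z \<in> {L..R}"
      by simp
    have "0 \<le> A"
      by (simp add: A_def)
    then have "k * (2 * (1 - c z)) \<le> (q z)\<^sup>2"
      using energy[OF z] by (simp add: algebra_simps)
    moreover have "k * ((y z)\<^sup>2 / (1 + B\<^sup>2)) \<le> k * (2 * (1 - c z))"
      using slope_square_le[OF B[OF z]] k by (intro mult_left_mono) (auto simp: c_def)
    ultimately have "k * (y z)\<^sup>2 / (1 + B\<^sup>2) \<le> (q z)\<^sup>2"
      by simp
    then have "k * (y z)\<^sup>2 \<le> (1 + B\<^sup>2) * (q z)\<^sup>2"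
      by (simp add: pos_divide_le_eq add_pos_nonneg mult.commute)
    then have "k * (k * (y z)\<^sup>2) \<le> k * ((1 + B\<^sup>2) * (q z)\<^sup>2)"
      using k by (intro mult_left_mono) auto
    moreover have "0 \<le> (q z - k * y z)\<^sup>2"
      by simp
    ultimately show "- K * (q z)\<^sup>2 \<le> 2 * q z * (- k * y z)"
      by (simp add: K_def power2_diff algebra_simps power2_eq_square)
  qed (use z in auto)
  have q_pos: "0 < q z" if z: "z \<in> {L..R}" for z
  proof (rule ccontr)
    assume "\<not> 0 < q z"
    then have "\<exists>x. L \<le> x \<and> x \<le> z \<and> q x = 0"
      using p 0 z by (intro IVT2' continuous_on_subset[OF cont_q]) (auto simp: q_def)
    then show False
      using q_sq z by fastforce
  qed
  have A: "0 < A"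
    using q_sq[of m] m by (simp add: A_def)
  have q_eq: "q z = curvature k A (w z)" if z: "z \<in> {L..R}" for z
    using energy[OF z] q_pos[OF z] unfolding curvature_def w_def c_def cosine_of_slope_eq
    by (metis real_sqrt_unique less_imp_le)
  have p_eq: "p = curvature k A w0"
    using q_eq[of L] LR 0 ends by (simp add: q_def w_def)

  have position: "T (w z) = T w0 + (z - L)"
    if T: "\<And>s. (T has_real_derivative - 1 / curvature k A s) (at s)" and z: "z \<in> {L..R}" for T z
  proof -
    have "T (w z) - z = T (w L) - L"
    proof (rule DERIV_isconst2[OF LR])
      have "isCont T s" for s
        using T DERIV_isCont by blast
      then have "continuous_on UNIV T"
        by (simp add: continuous_on_eq_continuous_at)
      then show "continuous_on {L..R} (\<lambda>z. T (w z) - z)"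
        by (intro continuous_intros continuous_on_compose2[OF _ cont_w]) auto
      fix z assume z: "L < z" "z < R"
      have "(w has_real_derivative - q z) (at z)"
        using dw[of z] z by (simp add: w_def q_def)
      from DERIV_chain2[OF T this]
      have "((\<lambda>z. T (w z)) has_real_derivative 1) (at z)"
        using q_eq[of z] q_pos[of z] z by simp
      then show "((\<lambda>z. T (w z) - z) has_real_derivative 0) (at z)"
        by (auto intro!: derivative_eq_intros)
    qed (use z in auto)
    then show ?thesis
      using ends by (simp add: w_def)
  qed
  obtain T where T: "\<And>s. (T has_real_derivative - 1 / curvature k A s) (at s)"
    using inclination_position_exists[OF k A] by blast
  have width: "R - L = width k w0 A"
    using position[OF T, of R] width_eq_inclination_position_diff[OF T, of w0] w0 LR ends
    by (simp add: w_def)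
  show thesis
  proof (rule that[OF A _ width])
    show "P0 = \<sigma> * curvature k A w0"
      using p_eq \<sigma> by (simp add: p_def field_simps)
    show "pressure_width k w0 A = k * M + 2 * w0"
      using mass p_eq width by (simp add: pressure_width_def)
  next
    fix T z
    assume T: "\<And>s. (T has_real_derivative - 1 / curvature k A s) (at s)" and z: "z \<in> {L..R}"
    have "\<zeta> z = (curvature k A w0 - curvature k A (w z)) / k"
      using q_eq[OF z] p_eq k by (simp add: q_def field_simps)
    then show "\<exists>s. T s = T w0 + (z - L) \<and> \<zeta> z = (curvature k A w0 - curvature k A s) / k"
      using position[OF T z] by blast
  qed
qed

section \<open>Construction of the equilibrium\<close>

lemma smooth_on_Icc_derivative_closed:
  assumes step: "\<And>f. f \<in> S \<Longrightarrow> \<exists>f'\<in>S. \<forall>x\<in>{a..b}. (f has_real_derivative f' x) (at x within {a..b})"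
    and f: "f \<in> S"
  shows "smooth_on_Icc f a b"
proof -
  have "\<exists>D. \<forall>n. (D n \<in> S \<and> (n = 0 \<longrightarrow> D n = f)) \<and>
      (\<forall>x\<in>{a..b}. (D n has_real_derivative D (Suc n) x) (at x within {a..b}))"
  proof (rule dependent_nat_choice)
    fix h :: "real \<Rightarrow> real" and n :: nat
    assume "h \<in> S \<and> (n = 0 \<longrightarrow> h = f)"
    then show "\<exists>h'. (h' \<in> S \<and> (Suc n = 0 \<longrightarrow> h' = f)) \<and>
        (\<forall>x\<in>{a..b}. (h has_real_derivative h' x) (at x within {a..b}))"
      using step[of h] by auto
  qed (use f in auto)
  then show ?thesis
    unfolding smooth_on_Icc_def by blast
qed

inductive_set polynomials_in :: "(real \<Rightarrow> real) set \<Rightarrow> (real \<Rightarrow> real) set"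
  for G :: "(real \<Rightarrow> real) set" where
  generator: "f \<in> G \<Longrightarrow> f \<in> polynomials_in G"
| const: "(\<lambda>x. c) \<in> polynomials_in G"
| add: "f \<in> polynomials_in G \<Longrightarrow> h \<in> polynomials_in G \<Longrightarrow> (\<lambda>x. f x + h x) \<in> polynomials_in G"
| mult: "f \<in> polynomials_in G \<Longrightarrow> h \<in> polynomials_in G \<Longrightarrow> (\<lambda>x. f x * h x) \<in> polynomials_in G"

text \<open>If the derivative of each generator is a polynomial in the generators, then by the product rule
  so is the derivative of each such polynomial, and hence all higher derivatives exist.\<close>

lemma smooth_on_Icc_polynomial_system:
  assumes gen: "\<And>f. f \<in> G \<Longrightarrow>
      \<exists>f'\<in>polynomials_in G. \<forall>x\<in>{a..b}. (f has_real_derivative f' x) (at x within {a..b})"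
    and f: "f \<in> G"
  shows "smooth_on_Icc f a b"
proof (rule smooth_on_Icc_derivative_closed)
  fix f assume "f \<in> polynomials_in G"
  then show "\<exists>f'\<in>polynomials_in G. \<forall>x\<in>{a..b}. (f has_real_derivative f' x) (at x within {a..b})"
  proof induction
    case (generator f)
    then show ?case by (rule gen)
  next
    case (const c)
    show ?case
      by (intro bexI[OF _ polynomials_in.const[of 0]]) auto
  next
    case (add f h)
    then obtain f' h' where "f' \<in> polynomials_in G" "h' \<in> polynomials_in G"
      and "\<forall>x\<in>{a..b}. (f has_real_derivative f' x) (at x within {a..b})"
        "\<forall>x\<in>{a..b}. (h has_real_derivative h' x) (at x within {a..b})"
      by auto
    then show ?case
      by (intro bexI[of _ "\<lambda>x. f' x + h' x"]) (auto intro: polynomials_in.add DERIV_add)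
  next
    case (mult f h)
    then obtain f' h' where "f' \<in> polynomials_in G" "h' \<in> polynomials_in G"
      and "\<forall>x\<in>{a..b}. (f has_real_derivative f' x) (at x within {a..b})"
        "\<forall>x\<in>{a..b}. (h has_real_derivative h' x) (at x within {a..b})"
      by auto
    with mult.hyps show ?case
      by (intro bexI[of _ "\<lambda>x. f' x * h x + h' x * f x"])
         (auto intro: polynomials_in.add polynomials_in.mult DERIV_mult)
  qed
qed (use f in \<open>rule polynomials_in.generator\<close>)

lemma curvature_deriv:
  assumes "0 < k" "0 < A" "\<bar>s\<bar> < 1"
  shows "(curvature k A has_real_derivative k * s / (sqrt (1 - s\<^sup>2) * curvature k A s)) (at s)"
proof -
  have "0 < 1 - s\<^sup>2"
    using assms by (simp add: abs_square_less_1)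
  moreover have "0 < A + 2 * k * (1 - sqrt (1 - s\<^sup>2))"
    using curvature_pos[OF assms(1,2), of s] by (simp add: curvature_def)
  ultimately show ?thesis
    unfolding curvature_def[abs_def]
    by (auto intro!: derivative_eq_intros simp: divide_simps)
qed

lemma secant_deriv:
  assumes "\<bar>s\<bar> < (1::real)"
  shows "((\<lambda>s. 1 / sqrt (1 - s\<^sup>2)) has_real_derivative s * (1 / sqrt (1 - s\<^sup>2)) ^ 3) (at s)"
proof -
  define r where "r = sqrt (1 - s\<^sup>2)"
  have pos: "0 < 1 - s\<^sup>2"
    using assms by (simp add: abs_square_less_1)
  then have "((\<lambda>s. 1 / sqrt (1 - s\<^sup>2)) has_real_derivative (s / r) / (r * r)) (at s)"
    by (auto intro!: derivative_eq_intros simp: r_def divide_simps)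
  also have "(s / r) / (r * r) = s * (1 / r) ^ 3"
    by (simp add: power3_eq_cube)
  finally show ?thesis
    by (simp add: r_def)
qed

text \<open>The inverse of \<open>y \<mapsto> y / sqrt (1 + y\<^sup>2)\<close>.\<close>

lemma sine_of_tangent:
  assumes "\<bar>s\<bar> < (1::real)"
  defines "y \<equiv> s * (1 / sqrt (1 - s\<^sup>2))"
  shows "y / sqrt (1 + y\<^sup>2) = s"
proof -
  have pos: "0 < 1 - s\<^sup>2"
    using assms by (simp add: abs_square_less_1)
  then have "1 + y\<^sup>2 = 1 / (1 - s\<^sup>2)"
    by (simp add: y_def power_divide power_mult_distrib field_simps)
  then show ?thesis
    using pos by (simp add: y_def real_sqrt_divide)
qed

text \<open>The solution of \<open>w' = - curvature k A w\<close>, obtained as the inverse of \<open>T\<close>. The range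
  \<open>\<bar>w\<bar> < 1\<close>, where the inclination is not vertical, contains the contact inclinations in its
  interior, so that no one-sided derivatives occur in the construction.\<close>

lemma inclination_exists:
  assumes k: "0 < k" and A: "0 < A"
    and T: "\<And>s. (T has_real_derivative - 1 / curvature k A s) (at s)"
  obtains w where "\<And>s. w (T s) = s"
    "\<And>z. z \<in> {T 1<..<T (- 1)} \<Longrightarrow> T (w z) = z \<and> \<bar>w z\<bar> < 1"
    "\<And>z. z \<in> {T 1<..<T (- 1)} \<Longrightarrow> (w has_real_derivative - curvature k A (w z)) (at z)"
proof -
  have inj: "inj T"
    using inclination_position_inj[OF k A T] .
  have isCont_T: "isCont T s" for s
    using T DERIV_isCont by blast
  define w where "w = inv T"
  have wT: "w (T s) = s" for s
    unfolding w_def using inj by simp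
  have Tw: "T (w z) = z \<and> \<bar>w z\<bar> < 1" if z: "z \<in> {T 1<..<T (- 1)}" for z
  proof -
    have "continuous_on {-1..1} T"
      using isCont_T by (simp add: continuous_at_imp_continuous_on)
    then obtain s where s: "-1 \<le> s" "s \<le> 1" "T s = z"
      using IVT2'[of T 1 z "-1"] z by auto
    then have "s \<noteq> 1" "s \<noteq> - 1"
      using z by auto
    with s show ?thesis
      using wT[of s] by auto
  qed
  have "(w has_real_derivative - curvature k A (w z)) (at z)" if z: "z \<in> {T 1<..<T (- 1)}" for z
  proof -
    have "isCont w (T (w z))"
      by (rule isCont_inverse_function[of 1]) (auto simp: wT isCont_T)
    then have "(w has_real_derivative inverse (- 1 / curvature k A (w z))) (at z)"
      using z Tw curvature_pos[OF k A, of "w z"]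
      by (intro DERIV_inverse_function[where f = T and a = "T 1" and b = "T (- 1)"] T) auto
    then show ?thesis
      by simp
  qed
  with that wT Tw show thesis
    by blast
qed

text \<open>Choose \<open>A\<close> for the area, let \<open>w\<close> be the inverse of \<open>T\<close>, and read off the height from the
  curvature: \<open>\<zeta> = (p - curvature k A w) / k\<close>. Smoothness up to the contact points holds because
  \<open>\<zeta>\<close>, \<open>w\<close> and the secant \<open>v\<close> of the inclination satisfy the polynomial system \<open>\<zeta>' = w v\<close>,
  \<open>w' = k \<zeta> - p\<close>, \<open>v' = w v\<^sup>3 (k \<zeta> - p)\<close>.\<close>

lemma equilibrium_exists:
  assumes M: "0 < M" and g: "0 < g" and \<sigma>: "0 < \<sigma>" and \<gamma>: "0 < \<gamma>" "\<gamma> < \<sigma>"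
  shows "\<exists>P0 L R \<zeta>. 0 < P0 \<and> equilibrium M g \<sigma> \<gamma> (\<lambda>_. 0) (\<lambda>_. P0) P0 L R \<zeta>"
proof -
  define k where "k = g / \<sigma>"
  define w0 where "w0 = sqrt (1 - (\<gamma> / \<sigma>)\<^sup>2)"
  have k: "0 < k"
    using g \<sigma> by (simp add: k_def)
  have ratio: "0 < (\<gamma> / \<sigma>)\<^sup>2" "(\<gamma> / \<sigma>)\<^sup>2 < 1"
    using \<sigma> \<gamma> by (simp_all add: power_less_one_iff)
  then have w0: "0 < w0" "w0 < 1"
    by (simp_all add: w0_def)
  obtain A where A: "0 < A" and mass: "pressure_width k w0 A = k * M + 2 * w0"
    using pressure_width_surj[of k w0 "k * M + 2 * w0"] k w0 M by auto
  obtain T where T: "\<And>s. (T has_real_derivative - 1 / curvature k A s) (at s)"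
    using inclination_position_exists[OF k A] by blast
  note T_less = inclination_position_strict_antimono[OF k A T]
  obtain w where wT: "\<And>s. w (T s) = s"
    and Tw: "\<And>z. z \<in> {T 1<..<T (- 1)} \<Longrightarrow> T (w z) = z \<and> \<bar>w z\<bar> < 1"
    and dw: "\<And>z. z \<in> {T 1<..<T (- 1)} \<Longrightarrow> (w has_real_derivative - curvature k A (w z)) (at z)"
    using inclination_exists[OF k A T] by blast
  define L where "L = T w0"
  define R where "R = T (- w0)"
  define p where "p = curvature k A w0"
  define \<zeta> where "\<zeta> = (\<lambda>z. (p - curvature k A (w z)) / k)"
  define v where "v = (\<lambda>z. 1 / sqrt (1 - (w z)\<^sup>2))"
  have LR: "L < R"
    unfolding L_def R_def using T_less[of "- w0" w0] w0 by simp
  have sub: "{L..R} \<subseteq> {T 1<..<T (- 1)}"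
    using T_less[of w0 1] T_less[of "- 1" "- w0"] w0 by (auto simp: L_def R_def)
  have TwLR: "T (w z) = z" "\<bar>w z\<bar> < 1" if "z \<in> {L..R}" for z
    using Tw[OF subsetD[OF sub that]] by simp_all
  have wLR: "w L = w0" "w R = - w0"
    by (simp_all add: L_def R_def wT)
  have curv: "curvature k A (w z) = p - k * \<zeta> z" for z
    using k by (simp add: \<zeta>_def)
  have p: "0 < p"
    unfolding p_def by (rule curvature_pos[OF k A])

  have dw': "(w has_real_derivative k * \<zeta> z - p) (at z)" if "z \<in> {L..R}" for z
    using dw[of z] sub that curv[of z] by auto
  have d\<zeta>: "(\<zeta> has_real_derivative w z * v z) (at z)" if z: "z \<in> {L..R}" for z
  proof -
    define Q where "Q = curvature k A (w z)"
    have "\<bar>w z\<bar> < 1"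
      using TwLR z by simp
    from DERIV_chain2[OF curvature_deriv[OF k A this] dw[of z]]
    have "((\<lambda>z. curvature k A (w z)) has_real_derivative k * w z / (sqrt (1 - (w z)\<^sup>2) * Q) * - Q) (at z)"
      using sub z by (auto simp: Q_def)
    then have "(\<zeta> has_real_derivative (0 - k * w z / (sqrt (1 - (w z)\<^sup>2) * Q) * - Q) / k) (at z)"
      unfolding \<zeta>_def by (intro DERIV_cdivide DERIV_diff DERIV_const)
    moreover have "Q \<noteq> 0"
      using curvature_pos[OF k A, of "w z"] by (simp add: Q_def)
    ultimately show ?thesis
      using k by (simp add: v_def)
  qed
  have dv: "(v has_real_derivative w z * v z ^ 3 * (k * \<zeta> z - p)) (at z)" if z: "z \<in> {L..R}" for z
  proof -
    have "\<bar>w z\<bar> < 1"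
      using TwLR z by simp
    from DERIV_chain2[OF secant_deriv[OF this] dw'[OF z]] show ?thesis
      by (simp add: v_def)
  qed

  have smooth: "smooth_on_Icc \<zeta> L R"
  proof (rule smooth_on_Icc_polynomial_system[where G = "{\<zeta>, w, v}"])
    let ?P = "polynomials_in {\<zeta>, w, v}"
    have gens: "\<zeta> \<in> ?P" "w \<in> ?P" "v \<in> ?P"
      by (auto intro: polynomials_in.generator)
    have w': "(\<lambda>z. k * \<zeta> z + - p) \<in> ?P"
      by (intro polynomials_in.add polynomials_in.mult polynomials_in.const gens)
    have v': "(\<lambda>z. w z * (v z * (v z * v z)) * (k * \<zeta> z + - p)) \<in> ?P"
      by (intro polynomials_in.mult gens w')
    have \<zeta>': "(\<lambda>z. w z * v z) \<in> ?P"
      by (intro polynomials_in.mult gens)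
    fix f assume "f \<in> {\<zeta>, w, v}"
    then consider "f = \<zeta>" | "f = w" | "f = v"
      by auto
    then show "\<exists>f'\<in>?P. \<forall>x\<in>{L..R}. (f has_real_derivative f' x) (at x within {L..R})"
    proof cases
      case 1
      then show ?thesis
        using d\<zeta> by (intro bexI[OF _ \<zeta>']) (auto intro: has_field_derivative_at_within)
    next
      case 2
      then show ?thesis
        using dw' by (intro bexI[OF _ w']) (auto intro: has_field_derivative_at_within)
    next
      case 3
      then show ?thesis
        using dv by (intro bexI[OF _ v']) (auto intro: has_field_derivative_at_within simp: power3_eq_cube mult.assoc)
    qed
  qed simp

  \<comment> \<open>Between the endpoints \<open>\<bar>w\<bar> < w0\<close>, and the curvature increases with \<open>\<bar>w\<bar>\<close>.\<close>
  have positive: "0 < \<zeta> z" if z: "z \<in> {L<..<R}" for z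
  proof -
    have Twz: "T (w z) = z"
      using TwLR z by simp
    have "\<not> w0 \<le> w z"
      using T_less[of w0 "w z"] z Twz by (cases "w z = w0") (auto simp: L_def)
    moreover have "\<not> w z \<le> - w0"
      using T_less[of "w z" "- w0"] z Twz by (cases "w z = - w0") (auto simp: R_def)
    ultimately have "curvature k A (w z) < p"
      unfolding p_def using k w0 by (intro curvature_strict_mono) auto
    then show ?thesis
      using k by (simp add: \<zeta>_def)
  qed
  have ends: "\<zeta> L = 0" "\<zeta> R = 0"
    by (simp_all add: \<zeta>_def wLR p_def)

  have deriv_\<zeta>: "deriv \<zeta> z = w z * v z" if "z \<in> {L<..<R}" for z
    using d\<zeta>[of z] that by (intro DERIV_imp_deriv) auto
  have ode: "g * \<zeta> z - \<sigma> * deriv (\<lambda>y. deriv \<zeta> y / sqrt (1 + \<bar>deriv \<zeta> y\<bar>\<^sup>2)) z = \<sigma> * p"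
    if z: "z \<in> {L<..<R}" for z
  proof -
    have "w y = deriv \<zeta> y / sqrt (1 + \<bar>deriv \<zeta> y\<bar>\<^sup>2)" if y: "y \<in> {L<..<R}" for y
    proof -
      have "\<bar>w y\<bar> < 1"
        using TwLR y by simp
      then show ?thesis
        unfolding power2_abs deriv_\<zeta>[OF y] v_def by (rule sine_of_tangent[symmetric])
    qed
    then have "((\<lambda>y. deriv \<zeta> y / sqrt (1 + \<bar>deriv \<zeta> y\<bar>\<^sup>2)) has_real_derivative k * \<zeta> z - p) (at z)"
      using z by (intro has_field_derivative_transform_within_open[OF dw', of _ "{L<..<R}"]) auto
    from DERIV_imp_deriv[OF this] show ?thesis
      by (simp only:) (use \<sigma> in \<open>simp add: k_def right_diff_distrib\<close>)
  qed

  define \<tau> where "\<tau> = sqrt (\<sigma>\<^sup>2 - \<gamma>\<^sup>2) / \<gamma>"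
  \<comment> \<open>The sine at the contact points is \<open>\<plusminus> w0\<close>, which belongs to the prescribed slope.\<close>
  have vd: "vector_derivative \<zeta> (at z within {L..R}) = w z * v z" if z: "z \<in> {L..R}" for z
    using d\<zeta>[OF z] z LR
    by (intro vector_derivative_within_closed_interval)
       (auto simp flip: has_real_derivative_iff_has_vector_derivative
         intro: has_field_derivative_at_within)
  have "sqrt (1 - w0\<^sup>2) = \<gamma> / \<sigma>"
    using ratio \<sigma> \<gamma> by (simp add: w0_def)
  moreover have "\<tau> = w0 / (\<gamma> / \<sigma>)"
    using contact_slope(2,3)[OF \<sigma> \<gamma>] \<sigma> \<gamma> by (simp add: \<tau>_def w0_def field_simps)
  ultimately have "w0 * (1 / sqrt (1 - w0\<^sup>2)) = \<tau>"
    by simp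
  then have contact: "\<bar>vector_derivative \<zeta> (at L within {L..R})\<bar> = \<tau>"
      "\<bar>vector_derivative \<zeta> (at R within {L..R})\<bar> = \<tau>"
    using contact_slope(1)[OF \<sigma> \<gamma>, folded \<tau>_def] LR vd[of L] vd[of R] wLR by (auto simp: v_def)

  have "((\<lambda>z. k * \<zeta> z - p) has_integral w R - w L) {L..R}"
    using LR dw'
    by (intro fundamental_theorem_of_calculus)
       (auto simp flip: has_real_derivative_iff_has_vector_derivative
         intro: has_field_derivative_at_within)
  moreover have "((\<lambda>z. p) has_integral (R - L) * p) {L..R}"
    using has_integral_const_real[of p L R] LR by simp
  ultimately have "((\<lambda>z. (k * \<zeta> z - p) + p) has_integral (w R - w L) + (R - L) * p) {L..R}"
    by (rule has_integral_add)
  moreover have "(w R - w L) + (R - L) * p = k * M"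
    using mass width_eq_inclination_position_diff[OF T, of w0] w0
    unfolding wLR by (simp add: pressure_width_def L_def R_def p_def mult.commute)
  ultimately have "((\<lambda>z. k * \<zeta> z) has_integral k * M) {L..R}"
    by simp
  from has_integral_mult_right[OF this, of "1 / k"] have area: "(\<zeta> has_integral M) {L..R}"
    using k by simp

  have "equilibrium M g \<sigma> \<gamma> (\<lambda>_. 0) (\<lambda>_. \<sigma> * p) (\<sigma> * p) L R \<zeta>"
    unfolding equilibrium_def
    using LR smooth positive ends ode contact area by (simp add: \<tau>_def)
  moreover have "0 < \<sigma> * p"
    using \<sigma> p by simp
  ultimately show ?thesis
    by blast
qed

text \<open>The area determines \<open>A\<close> by strict monotonicity of \<open>pressure_width\<close>; then both profiles are read
  off from the same injective \<open>T\<close>.\<close>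

lemma equilibrium_unique:
  assumes eq: "equilibrium M g \<sigma> \<gamma> u p P0 L R \<zeta>" and eq': "equilibrium M g \<sigma> \<gamma> u' p' P0' L' R' \<zeta>'"
    and pos: "0 < M" "0 < g" "0 < \<sigma>" "0 < \<gamma>" "\<gamma> < \<sigma>"
  shows "P0' = P0" "R' - L' = R - L" "z \<in> {L..R} \<Longrightarrow> \<zeta>' (z + (L' - L)) = \<zeta> z"
proof -
  define k where "k = g / \<sigma>"
  define w0 where "w0 = sqrt (1 - (\<gamma> / \<sigma>)\<^sup>2)"
  have k: "0 < k"
    using pos by (simp add: k_def)
  have w0: "0 < w0" "w0 \<le> 1"
    using pos by (simp_all add: w0_def power_less_one_iff)
  obtain A where A: "0 < A" "P0 = \<sigma> * curvature k A w0" "R - L = width k w0 A"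
    "pressure_width k w0 A = k * M + 2 * w0"
    and A_profile: "\<And>T z. (\<And>s. (T has_real_derivative - 1 / curvature k A s) (at s)) \<Longrightarrow> z \<in> {L..R} \<Longrightarrow>
       \<exists>s. T s = T w0 + (z - L) \<and> \<zeta> z = (curvature k A w0 - curvature k A s) / k"
    using equilibrium_characterization[OF eq pos] unfolding k_def w0_def by blast
  obtain B where B: "0 < B" "P0' = \<sigma> * curvature k B w0" "R' - L' = width k w0 B"
    "pressure_width k w0 B = k * M + 2 * w0"
    and B_profile: "\<And>T z. (\<And>s. (T has_real_derivative - 1 / curvature k B s) (at s)) \<Longrightarrow> z \<in> {L'..R'} \<Longrightarrow>
       \<exists>s. T s = T w0 + (z - L') \<and> \<zeta>' z = (curvature k B w0 - curvature k B s) / k"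
    using equilibrium_characterization[OF eq' pos] unfolding k_def w0_def by blast
  have AB: "A = B"
    using pressure_width_inj[OF k w0 A(1) B(1)] A(4) B(4) by simp
  show "P0' = P0" and RL: "R' - L' = R - L"
    using A B AB by simp_all
  obtain T where T: "\<And>s. (T has_real_derivative - 1 / curvature k A s) (at s)"
    using inclination_position_exists[OF k A(1)] by blast
  assume z: "z \<in> {L..R}"
  then obtain s where s: "T s = T w0 + (z - L)" "\<zeta> z = (curvature k A w0 - curvature k A s) / k"
    using A_profile[OF T] by blast
  have "z + (L' - L) \<in> {L'..R'}"
    using z RL by auto
  then obtain t where t: "T t = T w0 + (z + (L' - L) - L')"
      "\<zeta>' (z + (L' - L)) = (curvature k A w0 - curvature k A t) / k"
    using B_profile[of T] T AB by blast
  have "s = t"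
    using injD[OF inclination_position_inj[OF k A(1) T], of s t] s(1) t(1) by simp
  with s t show "\<zeta>' (z + (L' - L)) = \<zeta> z"
    by simp
qed

section \<open>Existence and uniqueness up to translation\<close>

theorem theorem1p2:
  "\<exists>C1 C2 :: real \<Rightarrow> real \<Rightarrow> real \<Rightarrow> real \<Rightarrow> real.
     \<forall>M g \<sigma> \<gamma> :: real.
       0 < M \<and> 0 < g \<and> 0 < \<sigma> \<and> 0 < \<gamma> / \<sigma> \<and> \<gamma> / \<sigma> < 1 \<longrightarrow>
         0 < C1 M g \<sigma> \<gamma> \<and> 0 < C2 M g \<sigma> \<gamma> \<and>
         (\<exists>u p P0 L R \<zeta>.
            equilibrium M g \<sigma> \<gamma> u p P0 L R \<zeta> \<and>
            P0 = C1 M g \<sigma> \<gamma> \<and> R - L = C2 M g \<sigma> \<gamma>) \<and>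
         (\<forall>u p P0 L R \<zeta> u' p' P0' L' R' \<zeta>'.
            equilibrium M g \<sigma> \<gamma> u p P0 L R \<zeta> \<and>
            equilibrium M g \<sigma> \<gamma> u' p' P0' L' R' \<zeta>' \<longrightarrow>
            (\<exists>a. L' = L + a \<and> R' = R + a \<and> P0' = P0 \<and>
                 (\<forall>z\<in>{L..R}. \<zeta>' (z + a) = \<zeta> z) \<and>
                 (\<forall>(z1, z2)\<in>droplet L R \<zeta>.
                    u' (z1 + a, z2) = u (z1, z2) \<and> p' (z1 + a, z2) = p (z1, z2))))"
proof -
  define realized where "realized M g \<sigma> \<gamma> c \<longleftrightarrow> 0 < fst c \<and> 0 < snd c \<and>
      (\<exists>u p P0 L R \<zeta>. equilibrium M g \<sigma> \<gamma> u p P0 L R \<zeta> \<and> P0 = fst c \<and> R - L = snd c)"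
    for M g \<sigma> \<gamma> and c :: "real \<times> real"
  define C where "C M g \<sigma> \<gamma> = (SOME c. realized M g \<sigma> \<gamma> c)" for M g \<sigma> \<gamma>
  have C: "realized M g \<sigma> \<gamma> (C M g \<sigma> \<gamma>)"
    if "0 < M \<and> 0 < g \<and> 0 < \<sigma> \<and> 0 < \<gamma> / \<sigma> \<and> \<gamma> / \<sigma> < 1" for M g \<sigma> \<gamma>
  proof -
    from that have "0 < M" "0 < g" "0 < \<sigma>" "0 < \<gamma>" "\<gamma> < \<sigma>"
      by (auto simp: zero_less_divide_iff)
    from equilibrium_exists[OF this] obtain P0 L R \<zeta>
      where eq: "0 < P0" "equilibrium M g \<sigma> \<gamma> (\<lambda>_. 0) (\<lambda>_. P0) P0 L R \<zeta>"
      by blast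
    moreover from eq(2) have "0 < R - L"
      by (simp add: equilibrium_def)
    ultimately have "realized M g \<sigma> \<gamma> (P0, R - L)"
      unfolding realized_def fst_conv snd_conv by blast
    then show ?thesis
      unfolding C_def by (rule someI)
  qed
  have unique: "\<exists>a. L' = L + a \<and> R' = R + a \<and> P0' = P0 \<and>
                 (\<forall>z\<in>{L..R}. \<zeta>' (z + a) = \<zeta> z) \<and>
                 (\<forall>(z1, z2)\<in>droplet L R \<zeta>.
                    u' (z1 + a, z2) = u (z1, z2) \<and> p' (z1 + a, z2) = p (z1, z2))"
    if par: "0 < M \<and> 0 < g \<and> 0 < \<sigma> \<and> 0 < \<gamma> / \<sigma> \<and> \<gamma> / \<sigma> < 1"
      and eq: "equilibrium M g \<sigma> \<gamma> u p P0 L R \<zeta>" and eq': "equilibrium M g \<sigma> \<gamma> u' p' P0' L' R' \<zeta>'"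
    for M g \<sigma> \<gamma> u p P0 L R \<zeta> u' p' P0' L' R' \<zeta>'
  proof (intro exI conjI)
    from par have pos: "0 < M" "0 < g" "0 < \<sigma>" "0 < \<gamma>" "\<gamma> < \<sigma>"
      by (auto simp: zero_less_divide_iff)
    note same = equilibrium_unique[OF eq eq' pos]
    show "L' = L + (L' - L)" "R' = R + (L' - L)" "P0' = P0"
      using same(1,2) by simp_all
    show profile: "\<forall>z\<in>{L..R}. \<zeta>' (z + (L' - L)) = \<zeta> z"
      using same(3) by blast
    have "(z1 + (L' - L), z2) \<in> droplet L' R' \<zeta>'" if "(z1, z2) \<in> droplet L R \<zeta>" for z1 z2
      using that same(2) same(3)[of z1] by (auto simp: droplet_def)
    then show "\<forall>(z1, z2)\<in>droplet L R \<zeta>.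
        u' (z1 + (L' - L), z2) = u (z1, z2) \<and> p' (z1 + (L' - L), z2) = p (z1, z2)"
      using eq eq' same(1) unfolding equilibrium_def by fastforce
  qed
  show ?thesis
  proof (rule exI[of _ "\<lambda>M g \<sigma> \<gamma>. fst (C M g \<sigma> \<gamma>)"], rule exI[of _ "\<lambda>M g \<sigma> \<gamma>. snd (C M g \<sigma> \<gamma>)"],
      intro allI impI)
    fix M g \<sigma> \<gamma> :: real
    assume par: "0 < M \<and> 0 < g \<and> 0 < \<sigma> \<and> 0 < \<gamma> / \<sigma> \<and> \<gamma> / \<sigma> < 1"
    show "0 < fst (C M g \<sigma> \<gamma>) \<and> 0 < snd (C M g \<sigma> \<gamma>) \<and>
         (\<exists>u p P0 L R \<zeta>.
            equilibrium M g \<sigma> \<gamma> u p P0 L R \<zeta> \<and>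
            P0 = fst (C M g \<sigma> \<gamma>) \<and> R - L = snd (C M g \<sigma> \<gamma>)) \<and>
         (\<forall>u p P0 L R \<zeta> u' p' P0' L' R' \<zeta>'.
            equilibrium M g \<sigma> \<gamma> u p P0 L R \<zeta> \<and>
            equilibrium M g \<sigma> \<gamma> u' p' P0' L' R' \<zeta>' \<longrightarrow>
            (\<exists>a. L' = L + a \<and> R' = R + a \<and> P0' = P0 \<and>
                 (\<forall>z\<in>{L..R}. \<zeta>' (z + a) = \<zeta> z) \<and>
                 (\<forall>(z1, z2)\<in>droplet L R \<zeta>.
                    u' (z1 + a, z2) = u (z1, z2) \<and> p' (z1 + a, z2) = p (z1, z2))))"
    proof (intro conjI)
      show "0 < fst (C M g \<sigma> \<gamma>)" "0 < snd (C M g \<sigma> \<gamma>)"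
        "\<exists>u p P0 L R \<zeta>. equilibrium M g \<sigma> \<gamma> u p P0 L R \<zeta> \<and>
            P0 = fst (C M g \<sigma> \<gamma>) \<and> R - L = snd (C M g \<sigma> \<gamma>)"
        using C[OF par] unfolding realized_def by blast+
    qed (intro allI impI, elim conjE, rule unique[OF par])
  qed
qed

end
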